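(* Let $\mathcal{F} = \{f, g\}$ be an iterated function system on $\mathbb{R}^2$ with $f(x) = Ax + b_f$ and $g(x) = Sx + b_g$, where $b_f,b_g\in\mathbb{R}^2$, $S=\pm rI$ for some $r\in(0,1)$, and the respective fixed points $z_f$ and $z_g$ of $f$ and $g$ are distinct. Let $K$ be the attractor of $\mathcal{F}$, and suppose that for some $c\in(0,1)$ one of the following holds: (a) $\det(A)>0$ and $A^2=-cI$; or (b) $\det(A)<0$, $A^2=cI$, and $K$ is not contained in a single $1$-dimensional line. (No upper bound on $c+r$ is imposed; any sum $c+r>0$ is allowed.) Then: (1) If $c + r \ge 1$, then $K$ is connected. (2) If $c + r < 1$, then $K$ is totally disconnected.
   Context: $A$ and $S$ are real $2\times2$ matrices and $I$ is the $2\times 2$ identity matrix. The attractor $K$ of $\{f,g\}$ is the unique non-empty compact set $K\subset\mathbb{R}^2$ with $K=f(K)\cup g(K)$. *)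

theory Defs
  imports "HOL-Analysis.Analysis"
begin

text \<open>
  The attractor of a contracting iterated function system is its unique non-empty compact
  invariant set. Uniqueness is not made part of the predicate, so a result about
  \<open>is_attractor F K\<close> holds for every non-empty compact invariant set of \<open>F\<close>.
\<close>

definition is_attractor :: "('a::topological_space \<Rightarrow> 'a) set \<Rightarrow> 'a set \<Rightarrow> bool" where
  "is_attractor F K \<longleftrightarrow> compact K \<and> K \<noteq> {} \<and> K = (\<Union>h\<in>F. h ` K)"

definition totally_disconnected :: "'a::topological_space set \<Rightarrow> bool" where
  "totally_disconnected S \<longleftrightarrow> (\<forall>C. C \<subseteq> S \<and> connected C \<longrightarrow> (\<exists>x. C \<subseteq> {x}))"

end

theory Submission
  imports Defs
begin

text \<open>
  Put \<open>z_f\<close> at the origin and let \<open>e = z_g - z_f\<close>. Then \<open>f\<close> is the linear map \<open>A\<close>, whose square is the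
  scalar \<open>a = \<plusminus>c\<close>, and \<open>g\<close> sends \<open>v\<close> to \<open>s v + (1 - s) e\<close> with \<open>s = \<plusminus>r\<close>. Both halves reduce to the
  pair \<open>\<phi>(x) = a x\<close>, \<open>\<psi>(x) = s x + (1 - s)\<close> of contractions of the real line, whose ratios add up
  to \<open>c + r\<close> in absolute value.

  If \<open>c + r \<ge> 1\<close>: on the line through \<open>z_f\<close> and \<open>z_g\<close> the maps \<open>f \<circ> f\<close> and \<open>g\<close> act as \<open>\<phi>\<close> and \<open>\<psi>\<close>.
  Because the ratios are large, some compact interval is covered by its two images, and these overlap
  (\<open>self_covering_interval\<close>). A compact set covered by its own contracted copies lies in every compact
  non-empty set that the contractions preserve, so this interval lies in \<open>K\<close>
  (\<open>axis_interval_subset_attractor\<close>) and \<open>f(K)\<close> meets \<open>g(K)\<close>. Two pieces that meet make the attractor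
  of two contractions connected (\<open>connected_if_contracted_copies_meet\<close>); for \<open>f\<close> this uses a norm adapted
  to \<open>A\<close>.

  If \<open>c + r < 1\<close>: choose \<open>y\<close> with \<open>y \<bullet> e = y \<bullet> A e = 1\<close>. In the coordinates \<open>X = y \<bullet> A v\<close>,
  \<open>Y = y \<bullet> v\<close> the maps read \<open>f(X, Y) = (a Y, X)\<close> and \<open>g(X, Y) = (\<psi> X, \<psi> Y)\<close>. So the set \<open>U\<close> of all
  values of \<open>X\<close> and \<open>Y\<close> on \<open>K\<close> is covered by \<open>\<phi>(U)\<close> and \<open>\<psi>(U)\<close>, hence has measure at most \<open>c + r\<close>
  times itself, that is, measure zero. A null set on the line contains no interval, so both coordinates
  are constant on each connected part of \<open>K\<close>, and together they determine the point.

  The coordinates exist when \<open>e\<close> and \<open>A e\<close> are independent. If \<open>A e\<close> were a multiple of \<open>e\<close>, the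
  eigenvalue would be a real square root of \<open>a\<close>, which excludes \<open>a = -c\<close>; and for \<open>a = c\<close> the line
  through \<open>z_f\<close> and \<open>z_g\<close> would contain \<open>K\<close>.
\<close>

section \<open>Self-similar subsets of the line\<close>

text \<open>
  Scaling by \<open>p\<close> multiplies Lebesgue measure by \<open>\<bar>p\<bar>\<close>, so the measure of \<open>U\<close>, which is finite, is at most
  \<open>\<bar>a\<bar> + \<bar>s\<bar>\<close> times itself.
\<close>

lemma measure_0_if_covered_by_small_copies:
  fixes U :: "real set"
  assumes U: "compact U"
    and sub: "U \<subseteq> (\<lambda>x. a * x) ` U \<union> (\<lambda>x. s * x + t) ` U"
    and small: "\<bar>a\<bar> + \<bar>s\<bar> < 1"
  shows "measure lebesgue U = 0"
proof -
  have m: "U \<in> lmeasurable"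
    using U by (rule lmeasurable_compact)
  have affine_copy: "(\<lambda>x. p * x + q) ` U \<in> lmeasurable"
      "measure lebesgue ((\<lambda>x. p * x + q) ` U) = \<bar>p\<bar> * measure lebesgue U" for p q
  proof -
    show "(\<lambda>x. p * x + q) ` U \<in> lmeasurable"
      by (intro lmeasurable_compact compact_continuous_image U continuous_intros)
    show "measure lebesgue ((\<lambda>x. p * x + q) ` U) = \<bar>p\<bar> * measure lebesgue U"
      using measure_lebesgue_affine[of p q U] by (simp add: add.commute)
  qed
  have "measure lebesgue U
      \<le> measure lebesgue ((\<lambda>x. a * x + 0) ` U \<union> (\<lambda>x. s * x + t) ` U)"
    using sub m affine_copy(1)[of a 0] affine_copy(1)[of s t]
    by (intro measure_mono_fmeasurable) (auto intro: fmeasurable.Un)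
  also have "\<dots> \<le> measure lebesgue ((\<lambda>x. a * x + 0) ` U) + measure lebesgue ((\<lambda>x. s * x + t) ` U)"
    using affine_copy(1)[of a 0] affine_copy(1)[of s t]
    by (intro measure_Un_le) auto
  also have "\<dots> = (\<bar>a\<bar> + \<bar>s\<bar>) * measure lebesgue U"
    using affine_copy(2)[of a 0] affine_copy(2)[of s t] by (simp add: algebra_simps)
  finally have "(1 - (\<bar>a\<bar> + \<bar>s\<bar>)) * measure lebesgue U \<le> 0"
    by (simp add: algebra_simps)
  then have "measure lebesgue U \<le> 0"
    using small by (simp add: mult_le_0_iff)
  then show ?thesis
    by (simp add: measure_le_0_iff)
qed

lemma totally_disconnected_if_measure_0:
  fixes U :: "real set"
  assumes U: "compact U" and null: "measure lebesgue U = 0"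
  shows "totally_disconnected U"
  unfolding totally_disconnected_def
proof (intro allI impI)
  fix C assume C: "C \<subseteq> U \<and> connected C"
  have "x = y" if xy: "x \<in> C" "y \<in> C" "x \<le> y" for x y
  proof -
    have "{x..y} \<subseteq> C"
      using C xy connected_contains_Icc[of C x y] by blast
    then have "measure lebesgue {x..y} \<le> measure lebesgue U"
      using C U by (intro measure_mono_fmeasurable lmeasurable_compact) auto
    then show ?thesis
      using null xy(3) by simp
  qed
  then show "\<exists>x. C \<subseteq> {x}"
    by (metis linear singletonI subsetI)
qed

text \<open>
  The interval sought is the convex hull of the attractor of \<open>x \<mapsto> a x\<close> and \<open>x \<mapsto> s x + (1 - s)\<close>. One image
  starts at its left end and the other stops at its right end; their lengths add up to at least
  that of the interval, so they overlap. The end points depend on the signs of \<open>a\<close> and \<open>s\<close>.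
\<close>

lemma self_covering_interval:
  fixes a s :: real
  assumes a: "\<bar>a\<bar> < 1" and s: "\<bar>s\<bar> < 1" and large: "\<bar>a\<bar> + \<bar>s\<bar> \<ge> 1"
  obtains l u where
    "{l..u} \<subseteq> (\<lambda>x. a * x) ` {l..u} \<union> (\<lambda>x. s * x + (1 - s)) ` {l..u}"
    "(\<lambda>x. a * x) ` {l..u} \<inter> (\<lambda>x. s * x + (1 - s)) ` {l..u} \<noteq> {}"
proof -
  let ?\<phi> = "\<lambda>x. a * x" and ?\<psi> = "\<lambda>x. s * x + (1 - s)"
  note covered = that
  have "a \<noteq> 0" "s \<noteq> 0"
    using a s large by auto
  have cover: thesis
    if lu: "l \<le> u"
      and \<phi>: "?\<phi> ` {l..u} = {l..m}" and \<psi>: "?\<psi> ` {l..u} = {m'..u}"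
      and m: "l \<le> m'" "m' \<le> m" for l u m m'
  proof (rule covered[of l u])
    show "{l..u} \<subseteq> ?\<phi> ` {l..u} \<union> ?\<psi> ` {l..u}"
      unfolding \<phi> \<psi> using m by auto
    have "{m'..u} \<noteq> {}"
      unfolding \<psi>[symmetric] using lu by simp
    then have "m' \<in> {l..m} \<inter> {m'..u}"
      using m by auto
    then show "?\<phi> ` {l..u} \<inter> ?\<psi> ` {l..u} \<noteq> {}"
      unfolding \<phi> \<psi> by blast
  qed
  have \<phi>: "?\<phi> ` {l..u} = (if a > 0 then {a * l..a * u} else {a * u..a * l})" if "l \<le> u" for l u
    using that \<open>a \<noteq> 0\<close> by (simp add: image_mult_atLeastAtMost_if)
  have \<psi>: "?\<psi> ` {l..u} = (if s > 0 then {s * l + (1 - s)..s * u + (1 - s)}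
      else {s * u + (1 - s)..s * l + (1 - s)})" if "l \<le> u" for l u
    using that \<open>s \<noteq> 0\<close> by (simp add: image_affinity_atLeastAtMost)
  consider "a > 0" "s > 0" | "a > 0" "s < 0" | "a < 0" "s > 0" | "a < 0" "s < 0"
    using \<open>a \<noteq> 0\<close> \<open>s \<noteq> 0\<close> by linarith
  then show thesis
  proof cases
    case 1
    show thesis
      by (rule cover[of 0 1 a "1 - s"])
        (use 1 s large in \<open>simp_all add: \<phi> \<psi>\<close>)
  next
    case 2
    have "0 \<le> (1 - s) * (1 + s)" "(1 - s) * (1 + s) \<le> (1 - s) * a"
      using 2 s large by (auto intro!: mult_left_mono)
    then have "0 \<le> s * (1 - s) + (1 - s)" "s * (1 - s) + (1 - s) \<le> a * (1 - s)"
      by (simp_all add: algebra_simps)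
    then show thesis
      using 2 by (intro cover[of 0 "1 - s" "a * (1 - s)" "s * (1 - s) + (1 - s)"])
        (simp_all add: \<phi> \<psi>)
  next
    case 3
    have "(- a) * (- a + s - 1) \<ge> 0"
      using 3 a large by (intro mult_nonneg_nonneg) auto
    then have "s * a + (1 - s) \<le> a * a"
      using 3 large by (simp add: algebra_simps)
    moreover have "(1 - s) * (1 - a) \<ge> 0"
      using 3 s by simp
    then have "a \<le> s * a + (1 - s)"
      by (simp add: algebra_simps)
    ultimately show thesis
      using 3 by (intro cover[of a 1 "a * a" "s * a + (1 - s)"]) (simp_all add: \<phi> \<psi>)
  next
    case 4
    \<comment> \<open>The right end is the fixed point of \<open>x \<mapsto> s a x + (1 - s)\<close>: both maps reverse orientation, so \<open>\<psi>\<close> takes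
      the left end \<open>a \<beta>\<close> to the right end, and the left end is itself the image of \<open>\<beta>\<close> under \<open>\<phi>\<close>.\<close>
    define \<beta> where "\<beta> = (1 - s) / (1 - s * a)"
    have sa: "s * a < 1" "s * a > 0"
      using 4 a s mult_strict_mono[of "-s" 1 "-a" 1] by (auto simp: zero_less_mult_iff)
    have \<beta>: "\<beta> > 0" "\<beta> = s * a * \<beta> + (1 - s)"
      using sa 4 by (auto simp: \<beta>_def field_simps)
    have sum: "a * a + s * a - s - 1 \<ge> 0"
    proof -
      have "(- a) * (- a - s - 1) \<ge> 0"
        using 4 a large by (intro mult_nonneg_nonneg) auto
      then show ?thesis using 4 large by (simp add: algebra_simps)
    qed
    have 1: "s * \<beta> + (1 - s) \<le> a * a * \<beta>"
    proof -
      have "(a * a + s * a - s - 1) * \<beta> \<ge> 0"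
        using \<beta>(1) sum by (intro mult_nonneg_nonneg) auto
      then show ?thesis using \<beta>(2) by (simp add: algebra_simps)
    qed
    have 2: "a * \<beta> \<le> s * \<beta> + (1 - s)"
    proof -
      have "(1 - a) * (1 + s) * \<beta> \<ge> 0"
        using 4 s \<beta>(1) by simp
      then show ?thesis using \<beta>(2) by (simp add: algebra_simps)
    qed
    have "a * \<beta> \<le> \<beta>"
      using 4 \<beta>(1) by (simp add: mult_le_cancel_right1)
    then show thesis
      using 1 2 4 \<beta>(2)[symmetric]
      by (intro cover[of "a * \<beta>" \<beta> "a * a * \<beta>" "s * \<beta> + (1 - s)"])
        (simp_all add: \<phi> \<psi> mult.assoc)
  qed
qed

section \<open>Overlapping pieces make a connected set\<close>

text \<open>
  Call a two-valued function on \<open>K\<close> constant at scale \<open>\<epsilon>\<close> if it takes equal values at points with \<open>\<rho> \<le> \<epsilon>\<close>.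
  If every function that is constant at scale \<open>\<epsilon>\<close> is constant, the same holds at scale \<open>q \<epsilon>\<close>: composing
  with \<open>f\<close> and with \<open>g\<close> shows that the function is constant on each piece, and the pieces share a point.
  Starting from the bound \<open>B\<close> of \<open>\<rho>\<close>, arbitrarily small scales are reached. A separation
  of \<open>K\<close> into two closed parts would contradict this at a scale below the distance of the parts. The gauge \<open>\<rho>\<close> need not be the
  distance, since \<open>f\<close> may fail to contract the latter.
\<close>

lemma connected_if_contracted_copies_meet:
  fixes K :: "'a::heine_borel set" and \<rho> :: "'a \<Rightarrow> 'a \<Rightarrow> real"
  assumes K: "compact K" "K = f ` K \<union> g ` K" and meet: "f ` K \<inter> g ` K \<noteq> {}"
    and q: "0 \<le> q" "q < 1"
    and f: "\<And>x y. x \<in> K \<Longrightarrow> y \<in> K \<Longrightarrow> \<rho> (f x) (f y) \<le> q * \<rho> x y"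
    and g: "\<And>x y. x \<in> K \<Longrightarrow> y \<in> K \<Longrightarrow> \<rho> (g x) (g y) \<le> q * \<rho> x y"
    and bounded: "\<And>x y. x \<in> K \<Longrightarrow> y \<in> K \<Longrightarrow> \<rho> x y \<le> B"
    and dist: "\<And>x y. x \<in> K \<Longrightarrow> y \<in> K \<Longrightarrow> dist x y \<le> \<rho> x y"
  shows "connected K"
proof -
  have const: "\<forall>x\<in>K. \<forall>y\<in>K. h x = h y"
    if "\<And>x y. x \<in> K \<Longrightarrow> y \<in> K \<Longrightarrow> \<rho> x y \<le> B * q ^ n \<Longrightarrow> h x = h y"
    for n and h :: "'a \<Rightarrow> bool"
    using that
  proof (induction n arbitrary: h)
    case 0
    then show ?case using bounded by (metis mult.right_neutral power_0)
  next
    case (Suc n)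
    have mem: "f x \<in> K" "g x \<in> K" if "x \<in> K" for x
      using K(2) that by blast+
    have scale: "v \<le> B * q ^ Suc n" if "v \<le> q * u" "u \<le> B * q ^ n" for u v :: real
    proof -
      have "q * u \<le> q * (B * q ^ n)"
        using that(2) q(1) by (rule mult_left_mono)
      then show ?thesis using that(1) by (simp add: mult_ac)
    qed
    have on_f: "\<forall>x\<in>K. \<forall>y\<in>K. h (f x) = h (f y)"
      by (rule Suc.IH[of "\<lambda>x. h (f x)"]) (rule Suc.prems[OF mem(1) mem(1) scale[OF f]])
    have on_g: "\<forall>x\<in>K. \<forall>y\<in>K. h (g x) = h (g y)"
      by (rule Suc.IH[of "\<lambda>x. h (g x)"]) (rule Suc.prems[OF mem(2) mem(2) scale[OF g]])
    obtain k k' where k: "k \<in> K" "k' \<in> K" "f k = g k'"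
      using meet by blast
    have all: "h x = h (f k)" if "x \<in> K" for x
    proof -
      have "x \<in> f ` K \<union> g ` K" using that K(2) by blast
      then show ?thesis using on_f on_g k by (metis UnE imageE)
    qed
    show ?case
      by (intro ballI trans[OF all sym[OF all]])
  qed
  show ?thesis
    unfolding connected_closed_set[OF compact_imp_closed[OF K(1)]]
  proof (intro notI, elim exE conjE)
    fix P Q assume PQ: "closed P" "closed Q" "P \<noteq> {}" "Q \<noteq> {}" "P \<union> Q = K" "P \<inter> Q = {}"
    have "compact P"
      using PQ(1,5) K(1) compact_Int_closed[of K P] by (metis Int_absorb1 Un_upper1)
    then obtain d where d: "d > 0" "\<And>x y. x \<in> P \<Longrightarrow> y \<in> Q \<Longrightarrow> d \<le> dist x y"
      using separate_compact_closed[of P Q] PQ by blast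
    have "(\<lambda>n. B * q ^ n) \<longlonglongrightarrow> B * 0"
      by (intro tendsto_intros LIMSEQ_realpow_zero q)
    then have "\<forall>\<^sub>F n in sequentially. B * q ^ n < d"
      using d(1) by (intro order_tendstoD(2)) auto
    then obtain n where n: "B * q ^ n < d"
      by (auto simp: eventually_sequentially)
    have "\<forall>x\<in>K. \<forall>y\<in>K. (x \<in> P) = (y \<in> P)"
    proof (rule const[of n])
      fix x y assume xy: "x \<in> K" "y \<in> K" "\<rho> x y \<le> B * q ^ n"
      show "(x \<in> P) = (y \<in> P)"
      proof (rule ccontr)
        assume "(x \<in> P) \<noteq> (y \<in> P)"
        then have "x \<in> P \<and> y \<in> Q \<or> y \<in> P \<and> x \<in> Q"
          using xy(1,2) PQ(5) by blast
        then have "d \<le> dist x y"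
          using d(2)[of x y] d(2)[of y x] by (auto simp: dist_commute)
        then show False
          using dist[OF xy(1,2)] xy(3) n by linarith
      qed
    qed
    then show False using PQ by blast
  qed
qed

section \<open>A linear square root of a scalar together with a homothety\<close>

text \<open>
  Here \<open>z\<close> is the fixed point of \<open>f\<close> and \<open>z + e\<close> is fixed by \<open>g\<close>. The line through them is called the axis.
\<close>

locale root_homothety_ifs =
  fixes T :: "'a::euclidean_space \<Rightarrow> 'a" and a s :: real and z e :: 'a
    and f g :: "'a \<Rightarrow> 'a" and K :: "'a set"
  assumes T: "linear T" "\<And>v. T (T v) = a *\<^sub>R v"
    and f: "\<And>p. f p - z = T (p - z)"
    and g: "\<And>p. g p - z = s *\<^sub>R (p - z) + (1 - s) *\<^sub>R e"
    and K: "is_attractor {f, g} K"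
begin

lemma attractor:
  shows compact_K: "compact K" and K_nonempty: "K \<noteq> {}" and K_eq: "K = f ` K \<union> g ` K"
  using K unfolding is_attractor_def by auto

lemma f_in_K: "p \<in> K \<Longrightarrow> f p \<in> K" and g_in_K: "p \<in> K \<Longrightarrow> g p \<in> K"
  using K_eq by blast+

lemma K_cases:
  assumes "p \<in> K"
  obtains p' where "p' \<in> K" "p = f p'" | p' where "p' \<in> K" "p = g p'"
  using assms K_eq by blast

lemma f_f: "f (f p) - z = a *\<^sub>R (p - z)"
  by (simp add: f T)

lemma f_f_on_axis: "f (f (z + x *\<^sub>R e)) = z + (a * x) *\<^sub>R e"
  using f_f[of "z + x *\<^sub>R e"] by (simp add: diff_eq_eq add.commute)

lemma g_on_axis: "g (z + x *\<^sub>R e) = z + (s * x + (1 - s)) *\<^sub>R e"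
  using g[of "z + x *\<^sub>R e"] by (simp add: diff_eq_eq add.commute scaleR_add_left)

lemma f_f_diff: "f (f p) - f (f q) = a *\<^sub>R (p - q)"
  and f_diff: "f p - f q = T (p - q)"
  and g_diff: "g p - g q = s *\<^sub>R (p - q)"
proof -
  have "f (f p) - f (f q) = (f (f p) - z) - (f (f q) - z)" by simp
  then show "f (f p) - f (f q) = a *\<^sub>R (p - q)"
    unfolding f_f by (simp add: algebra_simps)
  have "f p - f q = (f p - z) - (f q - z)" by simp
  then show "f p - f q = T (p - q)"
    unfolding f using linear_diff[OF T(1), of "p - z" "q - z"] by simp
  have "g p - g q = (g p - z) - (g q - z)" by simp
  then show "g p - g q = s *\<^sub>R (p - q)"
    unfolding g by (simp add: algebra_simps)
qed

text \<open>
  At a point of the interval where the distance to \<open>K\<close> is greatest, write the point as the image of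
  another point of the interval. The image is closer to \<open>K\<close> by a factor below one, so the greatest
  distance is zero.
\<close>

lemma axis_interval_subset_attractor:
  assumes a: "\<bar>a\<bar> < 1" and s: "\<bar>s\<bar> < 1"
    and cover: "{l..u} \<subseteq> (\<lambda>x. a * x) ` {l..u} \<union> (\<lambda>x. s * x + (1 - s)) ` {l..u}"
    and x: "x \<in> {l..u}"
  shows "z + x *\<^sub>R e \<in> K"
proof -
  let ?\<delta> = "\<lambda>x. infdist (z + x *\<^sub>R e) K"
  have "continuous_on {l..u} ?\<delta>"
    by (intro continuous_intros)
  then obtain m where m: "m \<in> {l..u}" "\<And>y. y \<in> {l..u} \<Longrightarrow> ?\<delta> y \<le> ?\<delta> m"
    using continuous_attains_sup[of "{l..u}" ?\<delta>] x by auto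
  have shrink: "infdist (h w) K \<le> \<bar>t\<bar> * infdist w K"
    if h: "\<And>p. p \<in> K \<Longrightarrow> h p \<in> K" "\<And>p q. h p - h q = t *\<^sub>R (p - q)" for h t w
  proof -
    obtain k where k: "k \<in> K" "infdist w K = dist w k"
      using infdist_attains_inf[OF compact_imp_closed[OF compact_K] K_nonempty] by blast
    have "infdist (h w) K \<le> dist (h w) (h k)"
      using h(1) k(1) by (intro infdist_le)
    then show ?thesis
      using h(2) k(2) by (simp add: dist_norm)
  qed
  have "\<exists>t x'. \<bar>t\<bar> < 1 \<and> x' \<in> {l..u} \<and> ?\<delta> m \<le> \<bar>t\<bar> * ?\<delta> x'"
    using subsetD[OF cover m(1)]
  proof (elim UnE imageE)
    fix x' assume x': "m = a * x'" "x' \<in> {l..u}"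
    have "?\<delta> m \<le> \<bar>a\<bar> * ?\<delta> x'"
      using shrink[of "\<lambda>p. f (f p)" a "z + x' *\<^sub>R e"] f_in_K f_f_diff x'(1)
      by (simp add: f_f_on_axis)
    then show ?thesis using a x'(2) by blast
  next
    fix x' assume x': "m = s * x' + (1 - s)" "x' \<in> {l..u}"
    have "?\<delta> m \<le> \<bar>s\<bar> * ?\<delta> x'"
      using shrink[of g s "z + x' *\<^sub>R e"] g_in_K g_diff x'(1)
      by (simp add: g_on_axis)
    then show ?thesis using s x'(2) by blast
  qed
  then obtain t x' where t: "\<bar>t\<bar> < 1" "x' \<in> {l..u}" "?\<delta> m \<le> \<bar>t\<bar> * ?\<delta> x'"
    by blast
  have "?\<delta> m \<le> \<bar>t\<bar> * ?\<delta> m"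
    using t(3) mult_left_mono[OF m(2)[OF t(2)], of "\<bar>t\<bar>"] by linarith
  then have "(1 - \<bar>t\<bar>) * ?\<delta> m \<le> 0"
    by (simp add: algebra_simps)
  then have "?\<delta> m \<le> 0"
    using t(1) by (simp add: mult_le_0_iff)
  then have "?\<delta> x = 0"
    using m(2)[OF x] infdist_nonneg[of "z + x *\<^sub>R e" K] by linarith
  then show ?thesis
    using in_closed_iff_infdist_zero[OF compact_imp_closed[OF compact_K] K_nonempty] by blast
qed

theorem connected_attractor:
  assumes a: "\<bar>a\<bar> < 1" and s: "\<bar>s\<bar> < 1" and large: "\<bar>a\<bar> + \<bar>s\<bar> \<ge> 1"
  shows "connected K"
proof -
  obtain l u where
    cover: "{l..u} \<subseteq> (\<lambda>x. a * x) ` {l..u} \<union> (\<lambda>x. s * x + (1 - s)) ` {l..u}" and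
    overlap: "(\<lambda>x. a * x) ` {l..u} \<inter> (\<lambda>x. s * x + (1 - s)) ` {l..u} \<noteq> {}"
    using self_covering_interval[OF a s large] .
  obtain x y where xy: "x \<in> {l..u}" "y \<in> {l..u}" "a * x = s * y + (1 - s)"
    using overlap by blast
  have in_K: "z + x *\<^sub>R e \<in> K" "z + y *\<^sub>R e \<in> K"
    using axis_interval_subset_attractor[OF a s cover] xy(1,2) by blast+
  have "f (f (z + x *\<^sub>R e)) = g (z + y *\<^sub>R e)"
    using xy(3) by (simp add: f_f_on_axis g_on_axis)
  then have meet: "f ` K \<inter> g ` K \<noteq> {}"
    using f_in_K[OF in_K(1)] in_K(2) by blast

  \<comment> \<open>\<open>T\<close> itself may expand some vectors, but it scales this norm by exactly \<open>\<alpha>\<close>, since \<open>T\<close> exchanges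
    the two summands up to that factor.\<close>
  define \<alpha> where "\<alpha> = sqrt \<bar>a\<bar>"
  have \<alpha>: "0 < \<alpha>" "\<alpha> < 1" "\<alpha> * \<alpha> = \<bar>a\<bar>"
    using a s large by (auto simp: \<alpha>_def)
  define N where "N v = norm v + norm (T v) / \<alpha>" for v
  have N_T: "N (T v) = \<alpha> * N v" for v
    using \<alpha> by (simp add: N_def T(2) field_simps)
  have N_scaleR: "N (t *\<^sub>R v) = \<bar>t\<bar> * N v" for t v
    by (simp add: N_def linear_cmul[OF T(1)] algebra_simps)
  have N_nonneg: "N v \<ge> 0" for v
    using \<alpha>(1) by (simp add: N_def)
  obtain M where M: "M > 0" "\<And>v. norm (T v) \<le> M * norm v"
    using linear_bounded_pos[OF T(1)] by blast
  obtain d where d: "\<And>p. p \<in> K \<Longrightarrow> norm p \<le> d"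
    using compact_imp_bounded[OF compact_K] by (auto simp: bounded_iff)
  show ?thesis
  proof (rule connected_if_contracted_copies_meet[where q = "max \<alpha> \<bar>s\<bar>"
        and \<rho> = "\<lambda>p q. N (p - q)", OF compact_K K_eq meet])
    show "0 \<le> max \<alpha> \<bar>s\<bar>" "max \<alpha> \<bar>s\<bar> < 1"
      using \<alpha> s by auto
    show "N (f p - f q) \<le> max \<alpha> \<bar>s\<bar> * N (p - q)" for p q
      by (auto simp: f_diff N_T intro!: mult_right_mono N_nonneg)
    show "N (g p - g q) \<le> max \<alpha> \<bar>s\<bar> * N (p - q)" for p q
      by (auto simp: g_diff N_scaleR intro!: mult_right_mono N_nonneg)
    show "dist p q \<le> N (p - q)" for p q
      using \<alpha>(1) by (simp add: N_def dist_norm)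
    show "N (p - q) \<le> 2 * d + M * (2 * d) / \<alpha>" if "p \<in> K" "q \<in> K" for p q
    proof -
      have "norm (p - q) \<le> 2 * d"
        using d[OF that(1)] d[OF that(2)] norm_triangle_ineq4[of p q] by linarith
      moreover from this have "norm (T (p - q)) \<le> M * (2 * d)"
        using M(2)[of "p - q"] mult_left_mono[of "norm (p - q)" "2 * d" M] M(1) by linarith
      ultimately show ?thesis
        unfolding N_def using \<alpha>(1) by (intro add_mono divide_right_mono) auto
    qed
  qed
qed

text \<open>
  Since \<open>f\<close> turns the coordinate \<open>Y\<close> into \<open>X\<close> and \<open>X\<close> into \<open>a\<close> times \<open>Y\<close>, while \<open>g\<close> acts on both in the
  same way, the values of the two coordinates together form a null subset of the line.
\<close>

theorem totally_disconnected_attractor: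
  assumes small: "\<bar>a\<bar> + \<bar>s\<bar> < 1"
    and y: "y \<bullet> e = 1" "y \<bullet> T e = 1"
    and separating: "\<And>v. y \<bullet> v = 0 \<Longrightarrow> y \<bullet> T v = 0 \<Longrightarrow> v = 0"
  shows "totally_disconnected K"
proof -
  define X Y where "X p = y \<bullet> T (p - z)" and "Y p = y \<bullet> (p - z)" for p
  have cont: "continuous_on K X" "continuous_on K Y"
    unfolding X_def Y_def
    by (intro continuous_intros linear_continuous_on_compose[OF _ T(1)])+
  define U where "U = X ` K \<union> Y ` K"
  have "compact U"
    unfolding U_def by (intro compact_Un compact_continuous_image cont compact_K)
  have X_f: "X (f p) = a * Y p" and Y_f: "Y (f p) = X p" for p
    by (simp_all add: X_def Y_def f T(2))
  have X_g: "X (g p) = s * X p + (1 - s)" and Y_g: "Y (g p) = s * Y p + (1 - s)" for p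
    using y by (simp_all add: X_def Y_def g linear_add[OF T(1)] linear_cmul[OF T(1)] inner_add_right)
  let ?V = "(\<lambda>x. a * x) ` U \<union> (\<lambda>x. s * x + (1 - s)) ` U"
  have X: "X p \<in> ?V" if "p \<in> K" for p
    using that
  proof (cases rule: K_cases)
    case (1 p') then show ?thesis by (auto simp: X_f U_def)
  next
    case (2 p') then show ?thesis by (auto simp: X_g U_def)
  qed
  have Y: "Y p \<in> ?V" if "p \<in> K" for p
    using that
  proof (cases rule: K_cases)
    case (1 p') then show ?thesis using X[of p'] by (simp only: Y_f)
  next
    case (2 p') then show ?thesis by (auto simp: Y_g U_def)
  qed
  have "U \<subseteq> ?V"
    unfolding U_def using X Y unfolding U_def by blast
  then have U: "totally_disconnected U"
    using \<open>compact U\<close> small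
    by (intro totally_disconnected_if_measure_0 measure_0_if_covered_by_small_copies)
  show ?thesis
    unfolding totally_disconnected_def
  proof (intro allI impI)
    fix C assume C: "C \<subseteq> K \<and> connected C"
    have "connected (X ` C)" "connected (Y ` C)"
      using C cont by (auto intro!: connected_continuous_image intro: continuous_on_subset)
    moreover have "X ` C \<subseteq> U" "Y ` C \<subseteq> U"
      using C by (auto simp: U_def)
    ultimately obtain \<xi> \<eta> where "X ` C \<subseteq> {\<xi>}" "Y ` C \<subseteq> {\<eta>}"
      using U unfolding totally_disconnected_def by meson
    then have eq: "X p = X q" "Y p = Y q" if "p \<in> C" "q \<in> C" for p q
      using that by blast+
    have "p = q" if "p \<in> C" "q \<in> C" for p q
    proof -
      have "T (p - q) = T (p - z) - T (q - z)"
        using linear_diff[OF T(1), of "p - z" "q - z"] by simp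
      then have "y \<bullet> (p - q) = 0" "y \<bullet> T (p - q) = 0"
        using eq[OF that] by (simp_all add: X_def Y_def inner_diff_right)
      then show ?thesis using separating[of "p - q"] by simp
    qed
    then show "\<exists>x. C \<subseteq> {x}"
      by blast
  qed
qed

text \<open>
  Both maps shrink the height \<open>\<bar>n \<bullet> (p - z)\<bar>\<close> above the hyperplane, so its maximum over \<open>K\<close> is zero.
\<close>

lemma attractor_in_invariant_hyperplane:
  assumes n: "n \<bullet> e = 0" "\<And>v. n \<bullet> T v = \<mu> * (n \<bullet> v)"
    and contr: "\<bar>\<mu>\<bar> < 1" "\<bar>s\<bar> < 1" and p: "p \<in> K"
  shows "n \<bullet> (p - z) = 0"
proof -
  let ?h = "\<lambda>p. \<bar>n \<bullet> (p - z)\<bar>"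
  have "continuous_on K ?h"
    by (intro continuous_intros)
  then obtain m where m: "m \<in> K" "\<And>p. p \<in> K \<Longrightarrow> ?h p \<le> ?h m"
    using continuous_attains_sup[OF compact_K K_nonempty] by blast
  have "\<exists>t p'. \<bar>t\<bar> < 1 \<and> p' \<in> K \<and> ?h m = \<bar>t\<bar> * ?h p'"
    using m(1)
  proof (cases rule: K_cases)
    case (1 p')
    then show ?thesis using contr(1) by (auto simp: f n abs_mult)
  next
    case (2 p')
    then show ?thesis using contr(2) by (auto simp: g n abs_mult inner_add_right)
  qed
  then obtain t p' where t: "\<bar>t\<bar> < 1" "p' \<in> K" "?h m = \<bar>t\<bar> * ?h p'"
    by blast
  have "?h m \<le> \<bar>t\<bar> * ?h m"
    using t(3) mult_left_mono[OF m(2)[OF t(2)], of "\<bar>t\<bar>"] by linarith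
  then have "(1 - \<bar>t\<bar>) * ?h m \<le> 0"
    by (simp add: algebra_simps)
  then have "?h m \<le> 0"
    using t(1) by (simp add: mult_le_0_iff)
  then show ?thesis
    using m(2)[OF p] by linarith
qed

end

section \<open>The planar case\<close>

definition cross2 :: "real^2 \<Rightarrow> real^2 \<Rightarrow> real" where
  "cross2 v w = v $ 1 * w $ 2 - v $ 2 * w $ 1"

text \<open>Cramer's rule for expanding \<open>u\<close> in terms of \<open>v\<close> and \<open>w\<close>, without division.\<close>

lemma cross2_expansion:
  "cross2 v w *\<^sub>R u = cross2 u w *\<^sub>R v + cross2 v u *\<^sub>R w"
  by (simp add: cross2_def vec_eq_iff forall_2 algebra_simps)

lemma cross2_eq_0_imp_multiple:
  assumes "v \<noteq> 0" and "cross2 v w = 0"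
  obtains t where "w = t *\<^sub>R v"
proof -
  define u :: "real^2" where "u = vector [- v $ 2, v $ 1]"
  have "cross2 v u = v $ 1 * v $ 1 + v $ 2 * v $ 2"
    by (simp add: u_def cross2_def)
  then have u: "cross2 v u \<noteq> 0"
    using assms(1) by (auto simp: vec_eq_iff forall_2 add_nonneg_eq_0_iff)
  have "cross2 v u *\<^sub>R w = cross2 v u *\<^sub>R ((cross2 w u / cross2 v u) *\<^sub>R v)"
    using cross2_expansion[of v u w] assms(2) u by (simp del: scaleR_cancel_left)
  then have "w = (cross2 w u / cross2 v u) *\<^sub>R v"
    using u by (metis scaleR_cancel_left)
  then show thesis by (rule that)
qed

lemma cross2_matrix_vector_mult: "cross2 (A *v v) (A *v w) = det A * cross2 v w"
  by (simp add: cross2_def matrix_vector_mult_def det_2 sum_2 algebra_simps)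

lemma separating_functional:
  fixes e w :: "real^2"
  assumes indep: "cross2 e w \<noteq> 0"
  obtains y where "y \<bullet> e = 1" "y \<bullet> w = 1"
proof
  let ?u = "vector [w $ 2 - e $ 2, e $ 1 - w $ 1] :: real^2"
  let ?y = "(1 / cross2 e w) *\<^sub>R ?u"
  have "?u \<bullet> e = cross2 e w" "?u \<bullet> w = cross2 e w"
    by (simp_all add: inner_vec_def sum_2 cross2_def algebra_simps)
  then show "?y \<bullet> e = 1" "?y \<bullet> w = 1"
    using indep by simp_all
qed

theorem theorem6p5:
  fixes A S :: "real^2^2"
    and b_f b_g z_f z_g :: "real^2"
    and f g :: "real^2 \<Rightarrow> real^2"
    and c r :: real
    and K :: "(real^2) set"
  assumes f: "\<And>x. f x = A *v x + b_f"
    and g: "\<And>x. g x = S *v x + b_g"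
    and r: "0 < r" "r < 1"
    and S: "S = r *\<^sub>R mat 1 \<or> S = - (r *\<^sub>R mat 1)"
    and z_f: "f z_f = z_f"
    and z_g: "g z_g = z_g"
    and distinct: "z_f \<noteq> z_g"
    and K: "is_attractor {f, g} K"
    and c: "0 < c" "c < 1"
    and A: "(det A > 0 \<and> A ** A = - (c *\<^sub>R mat 1)) \<or>
            (det A < 0 \<and> A ** A = c *\<^sub>R mat 1 \<and>
              \<not> (\<exists>L. affine L \<and> aff_dim L = 1 \<and> K \<subseteq> L))"
  shows "(c + r \<ge> 1 \<longrightarrow> connected K) \<and> (c + r < 1 \<longrightarrow> totally_disconnected K)"
proof -
  define e where "e = z_g - z_f"
  obtain s where s: "\<bar>s\<bar> = r" "S = s *\<^sub>R mat 1"
  proof (rule disjE[OF S])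
    assume "S = r *\<^sub>R mat 1"
    then show thesis using r(1) by (intro that[of r]) simp_all
  next
    assume "S = - (r *\<^sub>R mat 1)"
    then show thesis using r(1) by (intro that[of "- r"]) simp_all
  qed
  have S_v: "S *v v = s *\<^sub>R v" for v
    by (simp add: s(2) scaleR_matrix_vector_assoc[symmetric])
  obtain a where a: "\<bar>a\<bar> = c" "A ** A = a *\<^sub>R mat 1"
    and a_pos: "a > 0 \<Longrightarrow> det A < 0 \<and> \<not> (\<exists>L. affine L \<and> aff_dim L = 1 \<and> K \<subseteq> L)"
  proof (rule disjE[OF A], goal_cases)
    case 1
    show thesis by (rule 1(1)[of "- c"]) (use 1(2) c(1) in auto)
  next
    case 2
    show thesis by (rule 2(1)[of c]) (use 2(2) c(1) in auto)
  qed
  have AA: "A *v (A *v v) = a *\<^sub>R v" for v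
    by (simp add: matrix_vector_mul_assoc a(2) scaleR_matrix_vector_assoc[symmetric])
  have "f p - f z_f = A *v (p - z_f)" for p
    by (simp add: f matrix_vector_mult_diff_distrib)
  then have f_z: "f p - z_f = A *v (p - z_f)" for p
    by (simp add: z_f)
  have "g p - g z_g = s *\<^sub>R (p - z_g)" for p
    by (simp add: g S_v matrix_vector_mult_diff_distrib scaleR_diff_right)
  then have "g p - z_g = s *\<^sub>R (p - z_g)" for p
    by (simp add: z_g)
  then have g_z: "g p - z_f = s *\<^sub>R (p - z_f) + (1 - s) *\<^sub>R e" for p
    by (simp add: e_def algebra_simps)
  interpret root_homothety_ifs "\<lambda>v. A *v v" a s z_f e f g K
    by unfold_locales (simp_all add: AA f_z g_z K matrix_vector_right_distrib matrix_vector_mult_scaleR)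

  have indep: "cross2 e (A *v e) \<noteq> 0"
  proof
    assume zero: "cross2 e (A *v e) = 0"
    have "e \<noteq> 0"
      using distinct by (simp add: e_def)
    define n :: "real^2" where "n = vector [- e $ 2, e $ 1]"
    have n: "n \<bullet> v = cross2 e v" for v
      by (simp add: n_def inner_vec_def sum_2 cross2_def)
    obtain l where l: "A *v e = l *\<^sub>R e"
      using cross2_eq_0_imp_multiple[OF \<open>e \<noteq> 0\<close> zero] .
    have "(l * l) *\<^sub>R e = a *\<^sub>R e"
      using AA[of e] by (simp add: l matrix_vector_mult_scaleR)
    then have l_sq: "l * l = a"
      using \<open>e \<noteq> 0\<close> by simp
    then have "a > 0"
      using a(1) c(1) zero_le_square[of l] by linarith
    then have "a = c"
      using a(1) by simp
    have A': "det A < 0" "\<not> (\<exists>L. affine L \<and> aff_dim L = 1 \<and> K \<subseteq> L)"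
      using a_pos[OF \<open>a > 0\<close>] by blast+
    \<comment> \<open>The eigenvalues of \<open>A\<close> are \<open>l\<close> and \<open>- l\<close>, so \<open>A\<close> multiplies heights above the axis by \<open>- l\<close>.\<close>
    have "det A * det A = det (a *\<^sub>R mat 1 :: real^2^2)"
      by (simp only: a(2)[symmetric] det_mul)
    then have "(det A + l * l) * (det A - l * l) = 0"
      by (simp add: det_2 mat_def l_sq algebra_simps)
    then have "det A = - (l * l)"
      using A'(1) l_sq \<open>a > 0\<close> by auto
    then have "l * cross2 e (A *v v) = l * (- l * cross2 e v)" for v
      using cross2_matrix_vector_mult[of A e v] by (simp add: l cross2_def algebra_simps)
    moreover have "l \<noteq> 0"
      using l_sq \<open>a > 0\<close> by auto
    ultimately have "n \<bullet> (A *v v) = - l * (n \<bullet> v)" for v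
      unfolding n using mult_left_cancel by blast
    moreover have "n \<bullet> e = 0"
      by (simp add: n cross2_def)
    moreover have "\<bar>- l\<bar> < 1"
    proof -
      have "l\<^sup>2 < 1\<^sup>2"
        using l_sq \<open>a = c\<close> c(2) by (simp add: power2_eq_square)
      then show ?thesis by (simp add: abs_square_less_1)
    qed
    ultimately have "n \<bullet> (p - z_f) = 0" if "p \<in> K" for p
      using attractor_in_invariant_hyperplane[of n "- l" p] that s(1) r(2) by blast
    then have "K \<subseteq> {x. n \<bullet> x = n \<bullet> z_f}"
      by (auto simp: inner_diff_right)
    moreover have "n \<noteq> 0"
      using \<open>e \<noteq> 0\<close> by (auto simp: n_def vec_eq_iff forall_2)
    then have "aff_dim {x. n \<bullet> x = n \<bullet> z_f} = 1"
      by (simp add: aff_dim_hyperplane)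
    ultimately show False
      using A'(2) affine_hyperplane[of n "n \<bullet> z_f"] by blast
  qed

  obtain y where y: "y \<bullet> e = 1" "y \<bullet> (A *v e) = 1"
    using separating_functional[OF indep] .
  have separating: "v = 0" if v: "y \<bullet> v = 0" "y \<bullet> (A *v v) = 0" for v
  proof -
    let ?\<delta> = "cross2 e (A *v e)"
    define p q where "p = cross2 v (A *v e) / ?\<delta>" and "q = cross2 e v / ?\<delta>"
    have "?\<delta> *\<^sub>R v = ?\<delta> *\<^sub>R (p *\<^sub>R e + q *\<^sub>R (A *v e))"
      using cross2_expansion[of e "A *v e" v] indep
      by (simp add: p_def q_def scaleR_add_right del: scaleR_cancel_left)
    then have v_eq: "v = p *\<^sub>R e + q *\<^sub>R (A *v e)"
      using indep by (metis scaleR_cancel_left)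
    have "A *v v = p *\<^sub>R (A *v e) + (q * a) *\<^sub>R e"
      by (simp add: v_eq matrix_vector_right_distrib matrix_vector_mult_scaleR AA)
    then have "p + q = 0" "p + q * a = 0"
      using v y by (simp_all add: v_eq inner_add_right)
    moreover have "q * (1 - a) = (p + q) - (p + q * a)"
      by (simp add: algebra_simps)
    ultimately have "p + q = 0" "q * (1 - a) = 0"
      by simp_all
    then show "v = 0"
      using a(1) c(2) by (auto simp: v_eq)
  qed
  show ?thesis
    using connected_attractor totally_disconnected_attractor[OF _ y separating] a(1) s(1) c r
    by auto
qed

end
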